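(* Let $n\in\mathbb{N}$ (a positive integer) and let $c>0$ be real. For all bounded functions $f,g:[0,\infty)\to\mathbb{R}$ we have $$\left|L_n^{[c]}(fg)(x)-L_n^{[c]}f(x)\,L_n^{[c]}g(x)\right|\leq\frac12\,\mathrm{osc}(f)\,\mathrm{osc}(g),\quad x\geq 0,$$ where $$\mathrm{osc}(f)=\sup\left\{\left|f\left(\frac kn\right)-f\left(\frac ln\right)\right|:0\leq k<l<\infty\right\}$$ (with $k,l$ integers) and similarly for $\mathrm{osc}(g)$.
   Context: For $n\in\mathbb{N}$, $k\in\mathbb{N}\cup\{0\}$ and real $c>0$, the (generalized) Baskakov basis functions are $$p_{n,k}^{[c]}(x)=\binom{-n/c}{k}(-cx)^k(1+cx)^{-n/c-k},\quad x\geq 0,$$ where $\binom{a}{k}=\frac{a(a-1)\cdots(a-k+1)}{k!}$ is the generalized binomial coefficient and $0^0=1$. The generalized Baskakov operator is $$L_n^{[c]}f(x)=\sum_{k=0}^{\infty}p_{n,k}^{[c]}(x)\,f\left(\frac kn\right),\quad x\geq 0.$$ *)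

theory Defs
  imports "HOL-Analysis.Analysis"
begin

text \<open>
  Functions on $[0,\infty)$ are rendered as total functions on the reals; only their
  values at nonnegative arguments enter the notions below.
\<close>

definition baskakov_basis :: "real \<Rightarrow> nat \<Rightarrow> nat \<Rightarrow> real \<Rightarrow> real" where
  "baskakov_basis c n k x =
     ((- real n / c) gchoose k) * (- c * x) ^ k * (1 + c * x) powr (- real n / c - real k)"

definition baskakov :: "real \<Rightarrow> nat \<Rightarrow> (real \<Rightarrow> real) \<Rightarrow> real \<Rightarrow> real" where
  "baskakov c n f x = (\<Sum>k. baskakov_basis c n k x * f (real k / real n))"

text \<open>
  The oscillation depends on \<open>n\<close> through the nodes \<open>k / n\<close>. The supremum is a real one, hence
  meaningful when \<open>f\<close> is bounded on the nodes.
\<close>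

definition osc :: "nat \<Rightarrow> (real \<Rightarrow> real) \<Rightarrow> real" where
  "osc n f = Sup {\<bar>f (real k / real n) - f (real l / real n)\<bar> | k l :: nat. k < l}"

end

theory Submission
  imports Defs
begin

text \<open>
  The Baskakov basis is a probability distribution on the nodes, by the binomial series. The
  covariance is unchanged when \<open>f\<close> and \<open>g\<close> are shifted by constants. Centred at their midranges on
  the nodes, they are at most half of their oscillations in absolute value, so that both the mean
  of the product and the product of the means are at most a quarter of the product of the
  oscillations.
\<close>

text \<open>Pulling the k-th power of \<open>1 + c * x\<close> out of the \<open>powr\<close> leaves
  a fixed factor times a term of the binomial series at -y, where y = cx/(1 + cx). Since 0 \<le> y <
  1, this point lies in the disc of convergence for every x \<ge> 0, however large.\<close>

lemma baskakov_basis_conv_binomial_series: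
  assumes "c > 0" "x \<ge> 0"
  shows "baskakov_basis c n k x =
    (1 + c * x) powr (- real n / c) * (((- real n / c) gchoose k) * (- (c * x / (1 + c * x))) ^ k)"
proof -
  have pos: "1 + c * x > 0"
    using assms by (simp add: add_pos_nonneg)
  have "(1 + c * x) powr (- real n / c - real k)
      = (1 + c * x) powr (- real n / c) / (1 + c * x) ^ k"
    using pos by (simp add: powr_diff powr_realpow)
  moreover have "(- (c * x / (1 + c * x))) ^ k = (- c * x) ^ k / (1 + c * x) ^ k"
    by (metis minus_divide_left mult_minus_left power_divide)
  ultimately show ?thesis
    unfolding baskakov_basis_def by simp
qed

lemma sums_baskakov_basis:
  assumes "c > 0" "x \<ge> 0"
  shows "(\<lambda>k. baskakov_basis c n k x) sums 1"
proof -
  define y where "y = c * x / (1 + c * x)"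
  have pos: "1 + c * x > 0"
    using assms by (simp add: add_pos_nonneg)
  have "0 \<le> y" "y < 1"
    using assms pos by (auto simp: y_def field_simps)
  then have "(\<lambda>k. ((- real n / c) gchoose k) * (- y) ^ k) sums (1 + (- y)) powr (- real n / c)"
    by (intro gen_binomial_real) auto
  then have "(\<lambda>k. baskakov_basis c n k x) sums
      ((1 + c * x) powr (- real n / c) * (1 + (- y)) powr (- real n / c))"
    unfolding baskakov_basis_conv_binomial_series[OF assms] y_def[symmetric] by (rule sums_mult)
  \<comment> \<open>The sum of the binomial series is thus the reciprocal of the fixed factor in
    front.\<close>
  moreover have "1 + (- y) = inverse (1 + c * x)"
    using pos by (simp add: y_def field_simps)
  then have "(1 + c * x) powr (- real n / c) * (1 + (- y)) powr (- real n / c) = 1"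
    using pos by (simp flip: powr_mult)
  ultimately show ?thesis
    by simp
qed

text \<open>The sign (-1)^k of a binomial coefficient with negative upper entry cancels that of
  (-cx)^k, which leaves a rising factorial of n/c > 0.\<close>

lemma baskakov_basis_nonneg:
  assumes "c > 0" "x \<ge> 0"
  shows "baskakov_basis c n k x \<ge> 0"
proof -
  have "(- c * x) ^ k = (- 1) ^ k * (c * x) ^ k"
    using power_minus[of "c * x" k] by simp
  moreover have "(- 1) ^ k * (- 1) ^ k = (1::real)"
    by (simp flip: power_mult_distrib)
  ultimately have "((- real n / c) gchoose k) * (- c * x) ^ k
      = pochhammer (real n / c) k / fact k * (c * x) ^ k"
    by (simp add: gbinomial_pochhammer)
  then show ?thesis
    using assms unfolding baskakov_basis_def by (simp add: pochhammer_prod prod_nonneg)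
qed

text \<open>All values lie in the interval of length d that ends at their supremum; its centre
  serves as a.\<close>

lemma ex_midrange:
  fixes u :: "'a \<Rightarrow> real"
  assumes "\<And>k l. \<bar>u k - u l\<bar> \<le> d"
  shows "\<exists>a. \<forall>k. \<bar>u k - a\<bar> \<le> d / 2"
proof -
  have le: "u l \<le> u k + d" for k l
    using assms[of k l] by linarith
  then have "bdd_above (range u)"
    \<comment> \<open>Here \<open>undefined\<close> is just some index: any one value plus d bounds
      all the others.\<close>
    by (intro bdd_aboveI2[of _ _ "u undefined + d"]) auto
  then have "u k \<le> (SUP l. u l)" for k
    by (intro cSUP_upper) auto
  moreover have "(SUP l. u l) \<le> u k + d" for k
    using le by (intro cSUP_least) auto
  ultimately have "\<bar>u k - ((SUP l. u l) - d / 2)\<bar> \<le> d / 2" for k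
    unfolding abs_le_iff by (smt (verit) field_sum_of_halves)
  then show ?thesis
    by blast
qed

text \<open>The terms are dominated by \<open>p k * A\<close>, whose sum is A because the weights
  have total mass 1.\<close>

lemma
  fixes p u :: "nat \<Rightarrow> real"
  assumes "p sums 1" "\<And>k. p k \<ge> 0" "\<And>k. \<bar>u k\<bar> \<le> A"
  shows summable_weighted_bounded: "summable (\<lambda>k. p k * u k)"
    and abs_suminf_weighted_le: "\<bar>\<Sum>k. p k * u k\<bar> \<le> A"
proof -
  have pA: "(\<lambda>k. p k * A) sums A"
    using sums_mult2[OF assms(1), of A] by simp
  have le: "norm (p k * u k) \<le> p k * A" for k
    using assms(2,3)[of k] by (simp add: abs_mult mult_left_mono)
  show "summable (\<lambda>k. p k * u k)"
    by (rule summable_comparison_test'[OF sums_summable[OF pA] le])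
  have "norm (\<Sum>k. p k * u k) \<le> (\<Sum>k. p k * A)"
    using norm_suminf_le[OF le sums_summable[OF pA]] .
  then show "\<bar>\<Sum>k. p k * u k\<bar> \<le> A"
    using sums_unique[OF pA] by simp
qed

lemma abs_covariance_le:
  fixes p u v :: "nat \<Rightarrow> real"
  assumes p: "p sums 1" "\<And>k. p k \<ge> 0"
    and u: "\<And>k l. \<bar>u k - u l\<bar> \<le> d" and v: "\<And>k l. \<bar>v k - v l\<bar> \<le> e"
  shows "\<bar>(\<Sum>k. p k * (u k * v k)) - (\<Sum>k. p k * u k) * (\<Sum>k. p k * v k)\<bar> \<le> 1 / 2 * d * e"
proof -
  obtain a where a: "\<And>k. \<bar>u k - a\<bar> \<le> d / 2"
    using ex_midrange u by metis
  obtain b where b: "\<And>k. \<bar>v k - b\<bar> \<le> e / 2"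
    using ex_midrange v by metis
  \<comment> \<open>The diagonal k = l already forces this; it is needed to multiply the
    bounds.\<close>
  have de: "d \<ge> 0" "e \<ge> 0"
    using u[of 0 0] v[of 0 0] by auto
  have ab: "\<bar>(u k - a) * (v k - b)\<bar> \<le> d / 2 * (e / 2)" for k
    unfolding abs_mult using a b de by (intro mult_mono) auto
  define U where "U = (\<Sum>k. p k * (u k - a))"
  define V where "V = (\<Sum>k. p k * (v k - b))"
  define W where "W = (\<Sum>k. p k * ((u k - a) * (v k - b)))"
  have U: "(\<lambda>k. p k * (u k - a)) sums U"
    unfolding U_def by (rule summable_sums[OF summable_weighted_bounded[OF p a]])
  have V: "(\<lambda>k. p k * (v k - b)) sums V"
    unfolding V_def by (rule summable_sums[OF summable_weighted_bounded[OF p b]])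
  have W: "(\<lambda>k. p k * ((u k - a) * (v k - b))) sums W"
    unfolding W_def by (rule summable_sums[OF summable_weighted_bounded[OF p ab]])
  have "(\<lambda>k. p k * (u k - a) + a * p k) sums (U + a * 1)"
    by (intro sums_add sums_mult U p)
  then have u_eq: "(\<Sum>k. p k * u k) = U + a"
    by (simp add: algebra_simps sums_iff)
  have "(\<lambda>k. p k * (v k - b) + b * p k) sums (V + b * 1)"
    by (intro sums_add sums_mult V p)
  then have v_eq: "(\<Sum>k. p k * v k) = V + b"
    by (simp add: algebra_simps sums_iff)
  \<comment> \<open>Expansion of uv around (a, b): uv = (u - a)(v - b) + b(u - a) + a(v - b) +
    ab.\<close>
  have "(\<lambda>k. p k * ((u k - a) * (v k - b)) + (b * (p k * (u k - a)) + (a * (p k * (v k - b)) + a * b * p k)))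
      sums (W + (b * U + (a * V + a * b * 1)))"
    by (intro sums_add sums_mult U V W p)
  then have uv_eq: "(\<Sum>k. p k * (u k * v k)) = W + (b * U + (a * V + a * b))"
    by (simp add: algebra_simps sums_iff)
  have "\<bar>U\<bar> \<le> d / 2" "\<bar>V\<bar> \<le> e / 2" and W_le: "\<bar>W\<bar> \<le> d / 2 * (e / 2)"
    unfolding U_def V_def W_def
    using abs_suminf_weighted_le[OF p a] abs_suminf_weighted_le[OF p b]
      abs_suminf_weighted_le[OF p ab] by auto
  then have "\<bar>U * V\<bar> \<le> d / 2 * (e / 2)"
    unfolding abs_mult using de by (intro mult_mono) auto
  with W_le have "\<bar>W - U * V\<bar> \<le> 1 / 2 * d * e"
    by linarith
  \<comment> \<open>All terms with a or b cancel against (U + a)(V + b), leaving W - UV.\<close>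
  then show ?thesis
    unfolding u_eq v_eq uv_eq by (simp add: algebra_simps)
qed

lemma abs_diff_le_osc:
  assumes "bounded (f ` {0..})"
  shows "\<bar>f (real k / real n) - f (real l / real n)\<bar> \<le> osc n f"
proof -
  obtain B where "\<forall>t\<ge>0. \<bar>f t\<bar> \<le> B"
    using assms unfolding bounded_iff by auto
  then have B: "\<bar>f (real k / real n)\<bar> \<le> B" for k
    by simp
  have "bdd_above {\<bar>f (real k / real n) - f (real l / real n)\<bar> | k l :: nat. k < l}"
  proof (intro bdd_aboveI[of _ "2 * B"])
    fix y
    assume "y \<in> {\<bar>f (real k / real n) - f (real l / real n)\<bar> | k l :: nat. k < l}"
    then obtain k l where "y = \<bar>f (real k / real n) - f (real l / real n)\<bar>"
      by blast
    then show "y \<le> 2 * B"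
      using B[of k] B[of l] by linarith
  qed
  then have less: "\<bar>f (real k / real n) - f (real l / real n)\<bar> \<le> osc n f" if "k < l" for k l
    unfolding osc_def using that by (intro cSup_upper) auto
  \<comment> \<open>\<open>osc\<close> ranges over k < l only. The case k > l follows by symmetry;
    for k = l the left side is 0, and the pair (0, 1) shows that \<open>osc n f\<close> is
    nonnegative.\<close>
  show ?thesis
    using less[of k l] less[of l k] less[of 0 1] by (cases k l rule: linorder_cases) auto
qed

theorem corollary2p2:
  fixes n :: nat and c x :: real and f g :: "real \<Rightarrow> real"
  assumes "n \<ge> 1" and "c > 0"
    and "bounded (f ` {0..})" and "bounded (g ` {0..})"
    and "x \<ge> 0"
  shows "\<bar>baskakov c n (\<lambda>t. f t * g t) x - baskakov c n f x * baskakov c n g x\<bar>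
           \<le> 1 / 2 * osc n f * osc n g"
  unfolding baskakov_def
  using assms
  by (intro abs_covariance_le sums_baskakov_basis baskakov_basis_nonneg abs_diff_le_osc)

end
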